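(* Let $n\geq 10$ with $n\equiv 2\pmod 4$ and $r=4$. Let $V=\{v_1,\dots,v_n\}$ and consider the labelled path graph with edges: $\{v_1,v_2\}$ with the two labels $0$ and $2$; $\{v_2,v_3\}$ with label $1$; $\{v_3,v_4\}$ with label $0$; $\{v_4,v_5\}$ with label $1$; and for $5\leq s\leq n-1$, $\{v_s,v_{s+1}\}$ with label $2$ if $s$ is odd and label $3$ if $s$ is even. Then $G\cong A_n$ and $(G,(\rho_0,\rho_1,\rho_2,\rho_3))$ is a string C-group of rank 4 with Schläfli type $\{5,6,n-4\}$.
   Context: A string group generated by involutions (sggi) of rank $r$ is a pair $(G,(\rho_0,\dots,\rho_{r-1}))$ where $\rho_0,\dots,\rho_{r-1}$ are involutions generating the group $G$ such that $(\rho_i\rho_j)^2=1$ whenever $|i-j|\geq 2$. It is a string C-group if in addition it satisfies the intersection property: for all $J,K\subseteq\{0,\dots,r-1\}$, $\langle \rho_j : j\in J\rangle\cap\langle\rho_k : k\in K\rangle=\langle \rho_j : j\in J\cap K\rangle$. The Schläfli type is $\{p_1,\dots,p_{r-1}\}$ where $p_i$ is the order of $\rho_{i-1}\rho_i$. Labelled-graph convention: the vertex set $V$ is finite, and each edge $\{a,b\}$ ($a\neq b$) carries one or more labels from $\{0,\dots,r-1\}$, the edges carrying any given label being pairwise disjoint; $\rho_k$ denotes the permutation of $V$ equal to the product of the transpositions $(a\,b)$ over all edges $\{a,b\}$ carrying label $k$, and $G=\langle\rho_0,\dots,\rho_{r-1}\rangle\leq \mathrm{Sym}(V)$. *)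

theory Defs
  imports "HOL-Algebra.Sym_Groups" "HOL-Algebra.Multiplicative_Group"
begin

text \<open>A labelled graph on vertices (natural numbers) is given as a list of edges
 (a, b, L) with a \<noteq> b and L the set of labels of the edge {a,b}.
 rho_lab E k is the product of the transpositions (a b) over all edges carrying
 label k (these are pairwise disjoint, so the order of the product is irrelevant).\<close>

definition rho_lab :: "(nat \<times> nat \<times> nat set) list \<Rightarrow> nat \<Rightarrow> (nat \<Rightarrow> nat)" where
  "rho_lab E k = foldr (\<lambda>(a, b, L) p. if k \<in> L then Transposition.transpose a b \<circ> p else p) E id"

definition perm_gen_group :: "nat \<Rightarrow> (nat \<Rightarrow> nat) list \<Rightarrow> (nat \<Rightarrow> nat) monoid" where
  "perm_gen_group n rs = (sym_group n) \<lparr> carrier := generate (sym_group n) (set rs) \<rparr>"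

text \<open>String group generated by involutions (rank = length of the list).\<close>
definition sggi :: "('a, 'b) monoid_scheme \<Rightarrow> 'a list \<Rightarrow> bool" where
  "sggi G rs \<longleftrightarrow> group G
     \<and> (\<forall>i < length rs. rs ! i \<in> carrier G \<and> rs ! i \<noteq> \<one>\<^bsub>G\<^esub> \<and> rs ! i \<otimes>\<^bsub>G\<^esub> rs ! i = \<one>\<^bsub>G\<^esub>)
     \<and> generate G (set rs) = carrier G
     \<and> (\<forall>i < length rs. \<forall>j < length rs. (i + 2 \<le> j \<or> j + 2 \<le> i) \<longrightarrow>
          (rs ! i \<otimes>\<^bsub>G\<^esub> rs ! j) [^]\<^bsub>G\<^esub> (2::nat) = \<one>\<^bsub>G\<^esub>)"

definition string_C_group :: "('a, 'b) monoid_scheme \<Rightarrow> 'a list \<Rightarrow> bool" where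
  "string_C_group G rs \<longleftrightarrow> sggi G rs
     \<and> (\<forall>J K. J \<subseteq> {..<length rs} \<longrightarrow> K \<subseteq> {..<length rs} \<longrightarrow>
          generate G ((!) rs ` J) \<inter> generate G ((!) rs ` K) = generate G ((!) rs ` (J \<inter> K)))"

definition schlafli_type :: "('a, 'b) monoid_scheme \<Rightarrow> 'a list \<Rightarrow> nat list" where
  "schlafli_type G rs = map (\<lambda>i. group.ord G (rs ! (i - 1) \<otimes>\<^bsub>G\<^esub> rs ! i)) [1..<length rs]"

definition path_graph_4p2 :: "nat \<Rightarrow> (nat \<times> nat \<times> nat set) list" where
  "path_graph_4p2 n =
     [(1, 2, {0, 2}), (2, 3, {1}), (3, 4, {0}), (4, 5, {1})]
     @ map (\<lambda>s. (s, s + 1, if odd s then {2} else {3})) [5..<n]"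

end

theory Submission
  imports Defs
begin

text \<open>The group is alternating: the generators are even, and \<open>(1 2)(5 6)\<close>, a word in \<open>\<rho> 1\<close> and
  \<open>\<rho> 2\<close>, meets the support of \<open>\<rho> 3\<close> in one point only, so that their commutator is a 3-cycle;
  moving it along the path gives all 3-cycles \<open>(1 2 w)\<close>.

  The intersection property amounts to saying that each parabolic subgroup is the intersection of
  the maximal parabolic subgroups containing it. These are separated by what they preserve: without \<open>\<rho> 0\<close>
  the set \<open>{1,2,3}\<close>; without \<open>\<rho> 3\<close> the set \<open>{1..6}\<close>, on which the group acts as PSL(2,5); the other
  two split off a factor of order 2 from a dihedral group.\<close>

section \<open>Groups of functions generated by involutions\<close>

text \<open>The hypothesis \<open>n mod 4 = 2\<close> decides parity: \<open>\<rho> 2\<close> is a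
  product of 1 + (n - 4) / 2 transpositions and \<open>\<rho> 3\<close> of (n - 6) / 2, and among
  even n both numbers are even exactly for these.

  The obstacle is that \<open>\<rho> 2\<close> acts at both ends of the path at once, on {1,2} and
  on everything from 5 onwards, so that an element is not visibly determined by its action on one
  piece. In the group of \<open>\<rho> 2\<close> and \<open>\<rho> 3\<close>, the parity of a
  translation part records whether 1 and 2 are exchanged; this is well defined because n - 4 is
  even. In the group without \<open>\<rho> 3\<close>, one extra bit records the action beyond 6, and
  the word for (1 2)(5 6), which is \<open>\<rho> 2\<close> with that action erased, corrects
  it.\<close>

inductive_set words :: "('a \<Rightarrow> 'a) set \<Rightarrow> ('a \<Rightarrow> 'a) set" for S where
  id: "id \<in> words S"
| step: "s \<in> S \<Longrightarrow> x \<in> words S \<Longrightarrow> s \<circ> x \<in> words S"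

lemma words_incl: "s \<in> S \<Longrightarrow> s \<in> words S"
  using words.step[OF _ words.id] by fastforce

lemma words_comp: "x \<in> words S \<Longrightarrow> y \<in> words S \<Longrightarrow> x \<circ> y \<in> words S"
  by (induction rule: words.induct) (auto simp: comp_assoc intro: words.step)

lemma words_mono: "S \<subseteq> T \<Longrightarrow> words S \<subseteq> words T"
proof
  fix x assume "S \<subseteq> T" "x \<in> words S"
  from this(2,1) show "x \<in> words T"
    by (induction rule: words.induct) (auto intro: words.intros)
qed

lemma words_bij:
  assumes "x \<in> words S" and "\<And>s. s \<in> S \<Longrightarrow> s \<circ> s = id"
  shows "bij x"
  using assms
proof (induction rule: words.induct)
  case (step s x)
  then have "bij s" by (metis o_bij)
  with step show ?case by (metis bij_comp)
qed simp

lemma words_inv: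
  assumes "x \<in> words S" and invol: "\<And>s. s \<in> S \<Longrightarrow> s \<circ> s = id"
  shows "inv' x \<in> words S"
  using assms(1)
proof (induction rule: words.induct)
  case (step s x)
  have "bij s" using invol[OF step(1)] by (metis o_bij)
  moreover have "inv' s = s" using invol[OF step(1)] by (metis inv_unique_comp)
  moreover have "bij x" using words_bij[OF step(2) invol] .
  ultimately have "inv' (s \<circ> x) = inv' x \<circ> s" by (simp add: o_inv_distrib)
  then show ?case using words_comp[OF step(3) words_incl[OF step(1)]] by metis
qed (metis inv_id words.id)

text \<open>All occurrences of \<open>a\<close> move to the front and cancel in pairs. This is how a
  factor of order 2 splits off \<open>W {0,2,3}\<close> and \<open>W {0,1,3}\<close> below.\<close>

lemma words_insert_commuting:
  assumes "x \<in> words (insert a S)" and "a \<circ> a = id" and "\<And>s. s \<in> S \<Longrightarrow> s \<circ> a = a \<circ> s"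
  shows "\<exists>y \<in> words S. x = y \<or> x = a \<circ> y"
  using assms(1)
proof (induction rule: words.induct)
  case id
  then show ?case using words.id by blast
next
  case (step s x)
  then obtain y where y: "y \<in> words S" "x = y \<or> x = a \<circ> y" by blast
  show ?case
  proof (cases "s \<in> S")
    case True
    then have "s \<circ> x = s \<circ> y \<or> s \<circ> x = a \<circ> (s \<circ> y)"
      using y(2) assms(3) by (metis comp_assoc)
    then show ?thesis using words.step[OF True y(1)] by blast
  next
    case False
    then have "s = a" using step by simp
    then have "s \<circ> x = a \<circ> y \<or> s \<circ> x = y"
      using y(2) assms(2) by (metis comp_assoc id_comp)
    then show ?thesis using y(1) by blast
  qed
qed

text \<open>Words carry no ambient group, so the same sets serve for subgroups of
  \<open>sym_group n\<close> and of the generated group.\<close>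

lemma generate_eq_words:
  assumes "group G" and "mult G = (\<circ>)" and "one G = id" and "S \<subseteq> carrier G"
    and invol: "\<And>s. s \<in> S \<Longrightarrow> s \<circ> s = id"
  shows "generate G S = words S"
proof
  interpret group G by fact
  show "generate G S \<subseteq> words S"
  proof
    fix x assume "x \<in> generate G S"
    then show "x \<in> words S"
    proof (induction rule: generate.induct)
      case (inv h)
      then have "inv\<^bsub>G\<^esub> h = h"
        using assms invol[OF inv] by (intro inv_equality) auto
      then show ?case using inv words_incl by simp
    qed (metis assms(3) words.id, metis words_incl, metis assms(2) words_comp)
  qed
  show "words S \<subseteq> generate G S"
  proof
    fix x assume "x \<in> words S"
    then show "x \<in> generate G S"
      by (induction rule: words.induct)
        (metis assms(3) generate.one, metis assms(2) generate.incl generate.eng)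
  qed
qed

section \<open>The labelled path\<close>

lemma rho_lab_Nil [simp]: "rho_lab [] k = id"
  by (simp add: rho_lab_def)

lemma rho_lab_Cons [simp]:
  "rho_lab ((a, b, L) # E) k = (if k \<in> L then Transposition.transpose a b \<circ> rho_lab E k else rho_lab E k)"
  by (simp add: rho_lab_def)

lemma rho_lab_append: "rho_lab (E @ F) k = rho_lab E k \<circ> rho_lab F k"
  by (induction E) (auto simp: comp_assoc)

definition tail :: "nat \<Rightarrow> (nat \<times> nat \<times> nat set) list" where
  "tail N = map (\<lambda>s. (s, s + 1, if odd s then {2} else {3})) [5..<N]"

lemma tail_5 [simp]: "tail 5 = []"
  by (simp add: tail_def)

lemma tail_Suc: "5 \<le> N \<Longrightarrow> tail (Suc N) = tail N @ [(N, N + 1, if odd N then {2} else {3})]"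
  by (simp add: tail_def)

lemma rho_tail_id: "k < 2 \<Longrightarrow> rho_lab (tail N) k = id"
  unfolding tail_def by (induction N) (auto simp: rho_lab_append)

text \<open>The asymmetric bounds \<open>v < N\<close> and \<open>v \<le> N\<close> describe a path
  cut off at an \<open>N\<close> of either parity, as the induction needs.\<close>

lemma rho_tail_2:
  "5 \<le> N \<Longrightarrow> rho_lab (tail N) 2 v =
    (if odd v \<and> 5 \<le> v \<and> v < N then v + 1 else if even v \<and> 6 \<le> v \<and> v \<le> N then v - 1 else v)"
proof (induction N arbitrary: v rule: nat_induct_at_least)
  case (Suc N)
  show ?case
    by (cases "odd N"; cases "v = N"; cases "v = Suc N")
      (use Suc.hyps in \<open>auto simp: tail_Suc rho_lab_append Suc.IH transpose_def le_Suc_eq less_Suc_eq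
        elim: oddE\<close>)
qed auto

lemma rho_tail_3:
  "5 \<le> N \<Longrightarrow> rho_lab (tail N) 3 v =
    (if even v \<and> 6 \<le> v \<and> v < N then v + 1 else if odd v \<and> 7 \<le> v \<and> v \<le> N then v - 1 else v)"
proof (induction N arbitrary: v rule: nat_induct_at_least)
  case (Suc N)
  show ?case
    by (cases "odd N"; cases "v = N"; cases "v = Suc N")
      (use Suc.hyps in \<open>auto simp: tail_Suc rho_lab_append Suc.IH transpose_def le_Suc_eq less_Suc_eq
        elim: oddE\<close>)
qed auto

lemma permutation_rho_lab: "permutation (rho_lab E k)"
  by (induction E) (auto intro!: permutation_compose permutation_swap_id)

text \<open>A count of transpositions: \<open>(N - 4) div 2\<close> is the number of odd s with 5 <=
  s < N.\<close>

lemma evenperm_rho_tail_2: "5 \<le> N \<Longrightarrow> evenperm (rho_lab (tail N) 2) \<longleftrightarrow> even ((N - 4) div 2)"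
proof (induction N rule: nat_induct_at_least)
  case (Suc N)
  have "odd N \<Longrightarrow> even ((Suc N - 4) div 2) \<longleftrightarrow> odd ((N - 4) div 2)"
    and "even N \<Longrightarrow> (Suc N - 4) div 2 = (N - 4) div 2"
    using Suc.hyps by presburger+
  moreover have "rho_lab (tail (Suc N)) 2 =
      (if odd N then rho_lab (tail N) 2 \<circ> Transposition.transpose N (Suc N) else rho_lab (tail N) 2)"
    using Suc.hyps by (auto simp: tail_Suc rho_lab_append)
  ultimately show ?case
    using Suc.IH evenperm_comp[OF permutation_rho_lab permutation_swap_id]
    by (metis evenperm_swap n_not_Suc_n)
qed auto

lemma evenperm_rho_tail_3: "5 \<le> N \<Longrightarrow> evenperm (rho_lab (tail N) 3) \<longleftrightarrow> even ((N - 5) div 2)"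
proof (induction N rule: nat_induct_at_least)
  case (Suc N)
  have "even N \<Longrightarrow> even ((Suc N - 5) div 2) \<longleftrightarrow> odd ((N - 5) div 2)"
    and "odd N \<Longrightarrow> (Suc N - 5) div 2 = (N - 5) div 2"
    using Suc.hyps by presburger+
  moreover have "rho_lab (tail (Suc N)) 3 =
      (if even N then rho_lab (tail N) 3 \<circ> Transposition.transpose N (Suc N) else rho_lab (tail N) 3)"
    using Suc.hyps by (auto simp: tail_Suc rho_lab_append)
  ultimately show ?case
    using Suc.IH evenperm_comp[OF permutation_rho_lab permutation_swap_id]
    by (metis evenperm_swap n_not_Suc_n)
qed auto

section \<open>The four involutions as explicit functions\<close>

locale path_4p2 =
  fixes n :: nat
  assumes n10: "n \<ge> 10" and n2: "n mod 4 = 2"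
begin

abbreviation \<rho> :: "nat \<Rightarrow> nat \<Rightarrow> nat" where
  "\<rho> \<equiv> rho_lab (path_graph_4p2 n)"

lemma even_n: "even n"
  using n2 by presburger

lemma path_eq: "path_graph_4p2 n = [(1, 2, {0, 2}), (2, 3, {1}), (3, 4, {0}), (4, 5, {1})] @ tail n"
  by (simp add: path_graph_4p2_def tail_def)

lemma \<rho>0: "\<rho> 0 = (\<lambda>v. if v = 1 then 2 else if v = 2 then 1 else if v = 3 then 4 else if v = 4 then 3 else v)"
  by (auto simp: path_eq rho_lab_append rho_tail_id transpose_def)

lemma \<rho>1: "\<rho> 1 = (\<lambda>v. if v = 2 then 3 else if v = 3 then 2 else if v = 4 then 5 else if v = 5 then 4 else v)"
  by (auto simp: path_eq rho_lab_append rho_tail_id transpose_def)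

lemma \<rho>2: "\<rho> 2 = (\<lambda>v. if v = 1 then 2 else if v = 2 then 1
    else if v < 5 \<or> n < v then v else if odd v then v + 1 else v - 1)"
proof
  fix v
  \<comment> \<open>As n is even, the last edge {n-1,n} has label 2, so the partner v + 1 of an odd
    v is still at most n.\<close>
  have "odd v \<and> v \<le> n \<Longrightarrow> v < n" using even_n by (cases "v = n") auto
  then show "\<rho> 2 v = (if v = 1 then 2 else if v = 2 then 1
    else if v < 5 \<or> n < v then v else if odd v then v + 1 else v - 1)"
    using n10 by (auto simp: path_eq rho_lab_append rho_tail_2 transpose_def le_Suc_eq)
qed

lemma \<rho>3: "\<rho> 3 = (\<lambda>v. if v < 6 \<or> n \<le> v then v else if even v then v + 1 else v - 1)"
proof
  fix v
  have "odd v \<and> v \<le> n \<Longrightarrow> v < n" using even_n by (cases "v = n") auto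
  moreover have "odd v \<and> v \<ge> 6 \<Longrightarrow> v \<ge> 7" by (cases "v = 6") auto
  ultimately show "\<rho> 3 v = (if v < 6 \<or> n \<le> v then v else if even v then v + 1 else v - 1)"
    using n10 by (auto simp: path_eq rho_lab_append rho_tail_3 transpose_def)
qed

lemma \<rho>_values:
  "\<rho> 0 0 = 0" "\<rho> 0 1 = 2" "\<rho> 0 2 = 1" "\<rho> 0 3 = 4" "\<rho> 0 4 = 3" "\<rho> 0 5 = 5" "\<rho> 0 6 = 6"
  "\<rho> 1 0 = 0" "\<rho> 1 1 = 1" "\<rho> 1 2 = 3" "\<rho> 1 3 = 2" "\<rho> 1 4 = 5" "\<rho> 1 5 = 4" "\<rho> 1 6 = 6"
  "\<rho> 2 0 = 0" "\<rho> 2 1 = 2" "\<rho> 2 2 = 1" "\<rho> 2 3 = 3" "\<rho> 2 4 = 4" "\<rho> 2 5 = 6" "\<rho> 2 6 = 5"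
  using n10 by (simp_all add: \<rho>0 \<rho>1[simplified] \<rho>2)

lemma less_4_cases: "i < 4 \<Longrightarrow> i = 0 \<or> i = 1 \<or> i = 2 \<or> i = (3::nat)"
  by auto

lemma \<rho>2_mem: "5 \<le> v \<Longrightarrow> v \<le> n \<Longrightarrow> 5 \<le> \<rho> 2 v \<and> \<rho> 2 v \<le> n"
proof -
  assume v: "5 \<le> v" "v \<le> n"
  have "odd v \<Longrightarrow> v < n" using v even_n by (cases "v = n") auto
  moreover have "even v \<Longrightarrow> v \<noteq> 5" by auto
  ultimately show ?thesis using v by (auto simp: \<rho>2)
qed

lemma \<rho>3_mem: "6 \<le> v \<Longrightarrow> v < n \<Longrightarrow> 6 \<le> \<rho> 3 v \<and> \<rho> 3 v < n"
proof -
  assume v: "6 \<le> v" "v < n"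
  have "even v \<Longrightarrow> v + 1 < n" using v even_n by (cases "v + 1 = n") auto
  moreover have "odd v \<Longrightarrow> v \<noteq> 6" by auto
  ultimately show ?thesis using v by (auto simp: \<rho>3)
qed

lemma \<rho>2_\<rho>2: "\<rho> 2 (\<rho> 2 v) = v"
proof -
  consider "v < 5 \<or> n < v" | "5 \<le> v" "v \<le> n" by linarith
  then show ?thesis
  proof cases
    case 2
    then show ?thesis using \<rho>2_mem[OF 2] by (auto simp: \<rho>2 split: if_splits)
  qed (auto simp: \<rho>2)
qed

lemma \<rho>3_\<rho>3: "\<rho> 3 (\<rho> 3 v) = v"
proof -
  consider "v < 6 \<or> n \<le> v" | "6 \<le> v" "v < n" by linarith
  then show ?thesis
  proof cases
    case 2
    then show ?thesis using \<rho>3_mem[OF 2] by (auto simp: \<rho>3 split: if_splits)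
  qed (auto simp: \<rho>3)
qed

lemma \<rho>_invol: "i < 4 \<Longrightarrow> \<rho> i \<circ> \<rho> i = id"
  using less_4_cases[of i] by (auto simp: fun_eq_iff \<rho>2_\<rho>2 \<rho>3_\<rho>3) (auto simp: \<rho>0 \<rho>1[simplified])

lemma \<rho>_permutes: "i < 4 \<Longrightarrow> \<rho> i permutes {1..n}"
proof -
  assume i: "i < 4"
  have "bij (\<rho> i)" using \<rho>_invol[OF i] o_bij by blast
  moreover have "\<rho> i v = v" if "v \<notin> {1..n}" for v
    using less_4_cases[OF i] that n10 by (auto simp: \<rho>0 \<rho>1[simplified] \<rho>2 \<rho>3)
  ultimately show ?thesis by (simp add: bij_iff permutes_def)
qed

lemma \<rho>_even: "i < 4 \<Longrightarrow> evenperm (\<rho> i)"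
proof -
  assume "i < 4"
  \<comment> \<open>The tail contributes an odd number of transpositions to \<open>\<rho> 2\<close>;
    the edge {1,2} makes the total even.\<close>
  have "odd ((n - 4) div 2)" and "even ((n - 5) div 2)"
    using n10 n2 by presburger+
  then show ?thesis
    using less_4_cases[OF \<open>i < 4\<close>] n10
    by (auto simp: path_eq rho_lab_append evenperm_comp permutation_rho_lab permutation_compose
        permutation_swap_id evenperm_swap evenperm_rho_tail_2 evenperm_rho_tail_3 rho_tail_id)
qed

lemma \<rho>_commute: "i < 4 \<Longrightarrow> j < 4 \<Longrightarrow> i + 2 \<le> j \<Longrightarrow> \<rho> i \<circ> \<rho> j = \<rho> j \<circ> \<rho> i"
proof -
  assume "i < 4" "j < 4" "i + 2 \<le> j"
  then consider "i = 0" "j = 2" | "i = 0" "j = 3" | "i = 1" "j = 3" by force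
  moreover have "odd x \<Longrightarrow> x - Suc 0 \<noteq> 5" for x :: nat
    by (cases "x = 6") auto
  ultimately show ?thesis
    by cases (use n10 in \<open>auto simp: fun_eq_iff \<rho>0 \<rho>1[simplified] \<rho>2 \<rho>3\<close>)
qed


section \<open>Intersections of parabolic subgroups\<close>

abbreviation W :: "nat set \<Rightarrow> (nat \<Rightarrow> nat) set" where
  "W J \<equiv> words (\<rho> ` J)"

lemma W_invol: "J \<subseteq> {..<4} \<Longrightarrow> s \<in> \<rho> ` J \<Longrightarrow> s \<circ> s = id"
  using \<rho>_invol by blast

lemma W_bij: "J \<subseteq> {..<4} \<Longrightarrow> x \<in> W J \<Longrightarrow> bij x"
  using words_bij W_invol by metis

lemma W_mono: "J \<subseteq> K \<Longrightarrow> W J \<subseteq> W K"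
  by (intro words_mono image_mono)

lemma W_incl: "i \<in> J \<Longrightarrow> \<rho> i \<in> W J"
  by (intro words_incl imageI)

lemma W_quotient: "J \<subseteq> {..<4} \<Longrightarrow> r \<circ> y \<in> W J \<Longrightarrow> y \<in> W J \<Longrightarrow> r \<in> W J"
proof -
  assume J: "J \<subseteq> {..<4}" and "r \<circ> y \<in> W J" and y: "y \<in> W J"
  moreover have "inv' y \<in> W J" using words_inv[OF y W_invol[OF J]] .
  moreover have "y \<circ> inv' y = id" using W_bij[OF J y] by (meson bij_is_surj surj_iff)
  ultimately show "r \<in> W J" using words_comp by (metis comp_assoc comp_id)
qed

lemma W_insert_cases:
  assumes "x \<in> W (insert i S)" and "i < 4" and "S \<subseteq> {..<4}"
    and "\<And>j. j \<in> S \<Longrightarrow> i + 2 \<le> j \<or> j + 2 \<le> i"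
  shows "\<exists>y \<in> W S. x = y \<or> x = \<rho> i \<circ> y"
proof (rule words_insert_commuting)
  show "x \<in> words (insert (\<rho> i) (\<rho> ` S))" using assms(1) by (simp only: image_insert)
  show "\<rho> i \<circ> \<rho> i = id" using \<rho>_invol[OF assms(2)] .
  show "s \<circ> \<rho> i = \<rho> i \<circ> s" if "s \<in> \<rho> ` S" for s
  proof -
    obtain j where j: "j \<in> S" "s = \<rho> j" using \<open>s \<in> \<rho> ` S\<close> by blast
    then have "j < 4" using assms(3) by blast
    then show ?thesis
      using assms(4)[OF j(1)] \<rho>_commute[OF assms(2)] \<rho>_commute[OF _ assms(2)] j(2) by metis
  qed
qed

lemma W_induct [consumes 1, case_names id step]:
  assumes "x \<in> W J" and "P id" and "\<And>i x. i \<in> J \<Longrightarrow> P x \<Longrightarrow> P (\<rho> i \<circ> x)"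
  shows "P x"
  using assms(1) by (induction rule: words.induct) (use assms(2,3) in blast)+

text \<open>The edge {3,4} carries the label 0 alone, so dropping that label cuts {1,2,3} off the
  path.\<close>

lemma W123_123: "x \<in> W {1,2,3} \<Longrightarrow> v \<in> {1,2,3} \<Longrightarrow> x v \<in> {1,2,3}"
proof (induction rule: W_induct)
  case (step i x)
  have "\<rho> i u \<in> {1,2,3}" if "u \<in> {1,2,3}" for u
    using that step(1) by (auto simp: \<rho>1[simplified] \<rho>2 \<rho>3)
  then show ?case using step by simp
qed simp

subsection \<open>The dihedral group of the last two generators\<close>

text \<open>Along the path from 5 to n, the reflections \<open>\<rho> 2\<close> and \<open>\<rho> 3\<close> act
  on this coordinate, taken modulo \<open>n - 4\<close>, as \<open>z \<mapsto> 1 - z\<close> and \<open>z \<mapsto> - z\<close>.\<close>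

definition \<psi> :: "nat \<Rightarrow> int" where
  "\<psi> v = (if even v then (int v - 4) div 2 else - ((int v - 5) div 2))"

abbreviation m :: int where "m \<equiv> int n - 4"

lemma \<psi>_\<rho>2: "5 \<le> v \<Longrightarrow> v \<le> n \<Longrightarrow> \<psi> (\<rho> 2 v) = 1 - \<psi> v"
  unfolding \<psi>_def \<rho>2 using even_n
  by (cases "even v") (auto elim!: evenE oddE)

text \<open>Negation modulo \<open>m\<close> fixes 0 and m/2, the coordinates of the end vertices 5
  and n. Only at n is the sum \<open>m\<close> instead of 0.\<close>

lemma \<psi>_\<rho>3: "5 \<le> v \<Longrightarrow> v \<le> n \<Longrightarrow> m dvd \<psi> (\<rho> 3 v) + \<psi> v"
proof -
  assume v: "5 \<le> v" "v \<le> n"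
  consider "v = n" | "v = 5" | "6 \<le> v" "v < n" using v by linarith
  then show ?thesis
  proof cases
    case 1
    then show ?thesis using even_n by (auto simp: \<psi>_def \<rho>3)
  next
    case 3
    then have "\<psi> (\<rho> 3 v) + \<psi> v = 0"
      unfolding \<psi>_def \<rho>3 by (cases "even v") (auto elim!: evenE oddE)
    then show ?thesis by simp
  qed (auto simp: \<psi>_def \<rho>3)
qed

lemma double_\<psi>: "2 * \<psi> v = (if even v then int v - 4 else 5 - int v)"
  unfolding \<psi>_def by (auto elim!: evenE oddE)

text \<open>The coordinates are integers in the interval from -m/2 (excluded) to m/2, so two of them
  differ by less than \<open>m\<close>.\<close>

lemma \<psi>_inj:
  assumes "5 \<le> v" "v \<le> n" "5 \<le> w" "w \<le> n" "m dvd \<psi> v - \<psi> w"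
  shows "v = w"
proof -
  have bound: "- m < 2 * \<psi> u - 1 \<and> 2 * \<psi> u \<le> m" if "5 \<le> u" "u \<le> n" for u
  proof -
    have "odd u \<Longrightarrow> u \<noteq> n" using even_n by blast
    then show ?thesis using that n10 by (auto simp: double_\<psi>)
  qed
  have "\<bar>\<psi> v - \<psi> w\<bar> < m"
    using bound[of v] bound[of w] assms(1-4) by linarith
  then have "\<psi> v = \<psi> w" using assms(5) zdvd_imp_le[of m "\<bar>\<psi> v - \<psi> w\<bar>"] by fastforce
  then have "(if even v then int v - 4 else 5 - int v) = (if even w then int w - 4 else 5 - int w)"
    using double_\<psi> by metis
  \<comment> \<open>Even vertices have positive coordinate and odd ones do not, so the two branches
    never meet.\<close>
  moreover have "int v - 4 \<noteq> 5 - int w" and "5 - int v \<noteq> int w - 4"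
    using assms(1,3) by linarith+
  ultimately show ?thesis by (simp split: if_splits)
qed

text \<open>The element acts as \<open>z \<mapsto> s * z + k\<close> on coordinates. Of the two
  generators only \<open>\<rho> 2\<close> changes the parity of \<open>k\<close>, so this parity
  also tells whether 1 and 2 are exchanged.\<close>

definition dih :: "int \<Rightarrow> int \<Rightarrow> (nat \<Rightarrow> nat) \<Rightarrow> bool" where
  "dih s k x \<longleftrightarrow> (s = 1 \<or> s = -1)
    \<and> (\<forall>v. 5 \<le> v \<and> v \<le> n \<longrightarrow> 5 \<le> x v \<and> x v \<le> n \<and> m dvd \<psi> (x v) - (s * \<psi> v + k))
    \<and> (\<forall>v. v < 5 \<or> n < v \<longrightarrow> x v = (if even k then v else \<rho> 2 v))"

lemma dih_id: "dih 1 0 id"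
  by (simp add: dih_def)

lemma \<rho>2_outside: "v < 5 \<or> n < v \<Longrightarrow> \<rho> 2 v < 5 \<or> n < \<rho> 2 v"
  by (auto simp: \<rho>2)

lemma dih_\<rho>2: assumes "dih s k x" shows "dih (- s) (1 - k) (\<rho> 2 \<circ> x)"
  unfolding dih_def
proof (intro conjI allI impI)
  fix v
  show "(\<rho> 2 \<circ> x) v = (if even (1 - k) then v else \<rho> 2 v)" if "v < 5 \<or> n < v"
    using assms that \<rho>2_\<rho>2[of v] unfolding dih_def by auto
  assume v: "5 \<le> v \<and> v \<le> n"
  then have x: "5 \<le> x v" "x v \<le> n" "m dvd \<psi> (x v) - (s * \<psi> v + k)"
    using assms unfolding dih_def by auto
  show "5 \<le> (\<rho> 2 \<circ> x) v" "(\<rho> 2 \<circ> x) v \<le> n" using \<rho>2_mem x by auto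
  have "\<psi> ((\<rho> 2 \<circ> x) v) - (- s * \<psi> v + (1 - k)) = - (\<psi> (x v) - (s * \<psi> v + k))"
    using \<psi>_\<rho>2[OF x(1,2)] by simp
  then show "m dvd \<psi> ((\<rho> 2 \<circ> x) v) - (- s * \<psi> v + (1 - k))"
    using x(3) by (metis dvd_minus_iff)
qed (use assms in \<open>auto simp: dih_def\<close>)

lemma dih_\<rho>3: assumes "dih s k x" shows "dih (- s) (- k) (\<rho> 3 \<circ> x)"
  unfolding dih_def
proof (intro conjI allI impI)
  fix v
  have "\<rho> 3 u = u" if "u < 5 \<or> n < u" for u using that by (auto simp: \<rho>3)
  then show "(\<rho> 3 \<circ> x) v = (if even (- k) then v else \<rho> 2 v)" if "v < 5 \<or> n < v"
    using assms that \<rho>2_outside[OF that] unfolding dih_def by auto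
  assume v: "5 \<le> v \<and> v \<le> n"
  then have x: "5 \<le> x v" "x v \<le> n" "m dvd \<psi> (x v) - (s * \<psi> v + k)"
    using assms unfolding dih_def by auto
  have "5 \<le> \<rho> 3 u \<and> \<rho> 3 u \<le> n" if "5 \<le> u" "u \<le> n" for u
  proof (cases "u = 5 \<or> u = n")
    case True
    then have "\<rho> 3 u = u" by (auto simp: \<rho>3[THEN fun_cong, of u])
    then show ?thesis using that by simp
  next
    case False
    then show ?thesis using \<rho>3_mem[of u] that by auto
  qed
  then show "5 \<le> (\<rho> 3 \<circ> x) v" "(\<rho> 3 \<circ> x) v \<le> n" using x by auto
  have "\<psi> ((\<rho> 3 \<circ> x) v) - (- s * \<psi> v + (- k)) = (\<psi> (\<rho> 3 (x v)) + \<psi> (x v)) - (\<psi> (x v) - (s * \<psi> v + k))"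
    by simp
  then show "m dvd \<psi> ((\<rho> 3 \<circ> x) v) - (- s * \<psi> v + (- k))"
    using x(3) \<psi>_\<rho>3[OF x(1,2)] by (metis dvd_diff)
qed (use assms in \<open>auto simp: dih_def\<close>)

text \<open>As \<open>m\<close> is even, the class of \<open>k\<close> modulo \<open>m\<close>
  determines its parity, and with it the action on 1 and 2.\<close>

lemma dih_unique:
  assumes x: "dih s k x" and y: "dih s l y" and kl: "m dvd k - l"
  shows "x = y"
proof
  fix v
  have "even m" using even_n by simp
  then have par: "even k \<longleftrightarrow> even l" using dvd_trans[OF \<open>even m\<close> kl] by simp
  show "x v = y v"
  proof (cases "5 \<le> v \<and> v \<le> n")
    case True
    have "\<psi> (x v) - \<psi> (y v) =
        (\<psi> (x v) - (s * \<psi> v + k)) - (\<psi> (y v) - (s * \<psi> v + l)) + (k - l)" by simp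
    moreover have "m dvd \<psi> (x v) - (s * \<psi> v + k)" "m dvd \<psi> (y v) - (s * \<psi> v + l)"
      using x y True unfolding dih_def by blast+
    ultimately have "m dvd \<psi> (x v) - \<psi> (y v)" using kl by (metis dvd_add dvd_diff)
    then show ?thesis using x y True \<psi>_inj unfolding dih_def by blast
  next
    case False
    then show ?thesis using x y par unfolding dih_def by (metis linorder_not_le)
  qed
qed

lemma W23_dih: "x \<in> W {2,3} \<Longrightarrow> \<exists>s k. dih s k x"
proof (induction rule: W_induct)
  case (step i x)
  then show ?case using dih_\<rho>2 dih_\<rho>3 by blast
qed (use dih_id in blast)

lemma m_dvd_small: "m dvd z \<Longrightarrow> \<bar>z\<bar> < 6 \<Longrightarrow> z = 0"
  using zdvd_imp_le[of m "\<bar>z\<bar>"] n10 by fastforce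

lemma \<psi>_5_6_7: "\<psi> 5 = 0" "\<psi> 6 = 1" "\<psi> 7 = -1"
  by (auto simp: \<psi>_def)

lemma dih_5_6_7:
  assumes "dih s k x"
  shows "5 \<le> x 5" "m dvd \<psi> (x 5) - k" "5 \<le> x 6" "m dvd \<psi> (x 6) - (s + k)" "m dvd \<psi> (x 7) - (k - s)"
proof -
  have *: "5 \<le> x v \<and> m dvd \<psi> (x v) - (s * \<psi> v + k)" if "5 \<le> v" "v \<le> 7" for v
  proof -
    have "v \<le> n" using that n10 by linarith
    with assms that show ?thesis unfolding dih_def by blast
  qed
  show "5 \<le> x 5" "m dvd \<psi> (x 5) - k" "5 \<le> x 6" "m dvd \<psi> (x 6) - (s + k)" "m dvd \<psi> (x 7) - (k - s)"
    using *[of 5] *[of 6] *[of 7] by (simp_all add: \<psi>_5_6_7)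
qed

lemma W01_fix: "x \<in> W {0,1} \<Longrightarrow> v = 0 \<or> 6 \<le> v \<Longrightarrow> x v = v"
  by (induction rule: W_induct) (auto simp: \<rho>0 \<rho>1[simplified])

text \<open>The vertices 6 and 7 have coordinates 1 and -1 and are fixed by \<open>\<rho> 0\<close>
  and \<open>\<rho> 1\<close>, so \<open>s + k\<close> is 1 and \<open>k - s\<close> is -1 modulo
  \<open>m\<close>. Subtracting excludes \<open>s = -1\<close>, since \<open>m\<close> is at least 6
  and cannot divide 4.\<close>

lemma W01_W23:
  assumes "x \<in> W {0,1}" and "x \<in> W {2,3}"
  shows "x = id"
proof -
  obtain s k where x: "dih s k x" using W23_dih[OF assms(2)] by blast
  have a: "m dvd 1 - (s + k)" and b: "m dvd -1 - (k - s)"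
    using dih_5_6_7(4,5)[OF x] W01_fix[OF assms(1)] by (auto simp: \<psi>_5_6_7)
  have "m dvd (1 - (s + k)) - (-1 - (k - s))" using a b by (rule dvd_diff)
  then have "m dvd 2 - 2 * s" by simp
  moreover have s: "s = 1 \<or> s = -1" using x unfolding dih_def by blast
  ultimately have "s = 1" using m_dvd_small[of "2 - 2 * s"] by auto
  then show ?thesis using a dih_unique[OF x _, of 0 id] dih_id by (simp add: dvd_minus_iff)
qed

subsection \<open>The group of the first three generators\<close>

text \<open>Away from the pairs swapped by \<open>\<rho> 2\<close> beyond 6, this group is a copy of PSL(2,5) acting
  on six points. It preserves one of its two orbits of triples, a 2-(6,3,2) design.\<close>

definition design :: "nat set set" where
  "design = {{1,2,3},{1,2,4},{1,3,5},{2,4,5},{2,3,6},{1,4,6},{3,4,5},{3,4,6},{2,5,6},{1,5,6}}"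

lemma W012_le6: "x \<in> W {0,1,2} \<Longrightarrow> v \<le> 6 \<Longrightarrow> x v \<le> 6"
proof (induction rule: W_induct)
  case (step i x)
  have "\<rho> i u \<le> 6" if "u \<le> 6" for u
  proof -
    have "u = 6 \<or> u \<le> 5" using that by linarith
    then show ?thesis using step(1) by (auto simp: \<rho>0 \<rho>1[simplified] \<rho>2)
  qed
  then show ?case using step by simp
qed simp

lemma W012_design: "x \<in> W {0,1,2} \<Longrightarrow> T \<in> design \<Longrightarrow> x ` T \<in> design"
proof (induction rule: W_induct)
  case (step i x)
  have "\<rho> i ` U \<in> design" if "U \<in> design" for U
    using that step(1) unfolding design_def
    by (elim insertE emptyE) (simp_all add: \<rho>_values[simplified] insert_commute)
  then show ?case using step by (metis image_comp)
qed simp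

lemma \<rho>2_ge7: "7 \<le> v \<Longrightarrow> 7 \<le> \<rho> 2 v"
  by (cases "v = 7") (auto simp: \<rho>2)

text \<open>Beyond 6 only \<open>\<rho> 2\<close> moves anything. This is the one bit that the
  action on the six points does not show.\<close>

lemma W012_ge7:
  "x \<in> W {0,1,2} \<Longrightarrow> (\<forall>v \<ge> 7. x v = v) \<or> (\<forall>v \<ge> 7. x v = \<rho> 2 v)"
proof (induction rule: W_induct)
  case (step i x)
  have fixed: "\<rho> j v = v" if "j \<in> {0,1}" "v \<ge> 7" for j v
    using that by (auto simp: \<rho>0 \<rho>1[simplified])
  consider "i \<in> {0,1}" | "i = 2" using step(1) by blast
  then show ?case
  proof cases
    case 1
    then show ?thesis using step(2) fixed \<rho>2_ge7 by (metis comp_apply)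
  next
    case 2
    then show ?thesis using step(2) \<rho>2_\<rho>2 by (metis comp_apply)
  qed
qed simp

text \<open>Each pair in {1,2,3} lies in exactly one block besides {1,2,3}. The third points of
  these blocks for 12, 13, 23 are 4, 5, 6, which happen to be the sum of the pair plus one.\<close>

lemma design_third_point:
  assumes "T \<in> design" "{a,b,c} \<subseteq> T" "a \<in> {1,2,3}" "b \<in> {1,2,3}" "a \<noteq> b" "c \<notin> {1,2,3}"
  shows "c = a + b + 1"
  using assms(3,4,1,2,5,6) unfolding design_def by (elim insertE emptyE) simp_all

lemma W012_0: "x \<in> W {0,1,2} \<Longrightarrow> x 0 = 0"
  by (induction rule: W_induct) (auto simp: \<rho>0 \<rho>1[simplified] \<rho>2)

definition \<sigma> :: "nat \<Rightarrow> nat" where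
  "\<sigma> = (\<lambda>v. if v = 1 then 2 else if v = 2 then 1 else if v = 5 then 6 else if v = 6 then 5 else v)"

lemma nat_le6_cases: "(v::nat) = 0 \<or> v = 1 \<or> v = 2 \<or> v = 3 \<or> v = 4 \<or> v = 5 \<or> v = 6 \<or> 7 \<le> v"
  by linarith

lemma \<rho>1_ge6: "6 \<le> v \<Longrightarrow> \<rho> 1 v = v"
  by (auto simp: \<rho>1[simplified])

text \<open>On the first six points \<open>\<rho> 1 \<circ> \<rho> 2\<close> has order 3, so the
  word acts there as \<open>\<rho> 2\<close>. Beyond them \<open>\<rho> 1\<close> is trivial and the
  four letters \<open>\<rho> 2\<close> cancel.\<close>

lemma \<sigma>_word: "\<sigma> = \<rho> 2 \<circ> (\<rho> 1 \<circ> (\<rho> 2 \<circ> (\<rho> 1 \<circ> (\<rho> 2 \<circ> (\<rho> 1 \<circ> \<rho> 2)))))"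
proof
  fix v
  show "\<sigma> v = (\<rho> 2 \<circ> (\<rho> 1 \<circ> (\<rho> 2 \<circ> (\<rho> 1 \<circ> (\<rho> 2 \<circ> (\<rho> 1 \<circ> \<rho> 2)))))) v"
  proof (cases "7 \<le> v")
    case True
    then have "\<rho> 1 v = v" "\<rho> 1 (\<rho> 2 v) = \<rho> 2 v"
      using \<rho>2_ge7[OF True] \<rho>1_ge6 by auto
    then show ?thesis using True by (simp add: \<rho>2_\<rho>2 \<sigma>_def)
  next
    case False
    then show ?thesis
      using nat_le6_cases[of v] by (auto simp: \<rho>_values[simplified] \<sigma>_def)
  qed
qed

lemma \<sigma>_W: "1 \<in> J \<Longrightarrow> 2 \<in> J \<Longrightarrow> \<sigma> \<in> W J"
  unfolding \<sigma>_word by (intro words_comp W_incl)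

text \<open>The conditions describe the copy of the symmetric group of {1,2,3} that moves 4, 5, 6 as
  it moves the pairs 12, 13, 23. Its six elements are words in \<open>\<rho> 1\<close> and
  \<open>\<sigma>\<close>.\<close>

lemma W12_intro:
  assumes "x 0 = 0" and "\<And>v. 7 \<le> v \<Longrightarrow> x v = v"
    and "x 1 \<in> {1,2,3}" "x 2 \<in> {1,2,3}" "x 3 \<in> {1,2,3}"
    and "x 1 \<noteq> x 2" "x 1 \<noteq> x 3" "x 2 \<noteq> x 3"
    and "x 4 = x 1 + x 2 + 1" "x 5 = x 1 + x 3 + 1" "x 6 = x 2 + x 3 + 1"
  shows "x \<in> W {1,2}"
proof -
  have eqI: "x = y" if "\<And>v. 7 \<le> v \<Longrightarrow> y v = v" "y 0 = 0" "y 1 = x 1" "y 2 = x 2" "y 3 = x 3"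
      "y 4 = x 4" "y 5 = x 5" "y 6 = x 6" for y
  proof
    fix v show "x v = y v" using nat_le6_cases[of v] assms(1,2) that by metis
  qed
  consider "x 1 = 1" "x 2 = 2" "x 3 = 3" | "x 1 = 1" "x 2 = 3" "x 3 = 2"
    | "x 1 = 2" "x 2 = 1" "x 3 = 3" | "x 1 = 2" "x 2 = 3" "x 3 = 1"
    | "x 1 = 3" "x 2 = 1" "x 3 = 2" | "x 1 = 3" "x 2 = 2" "x 3 = 1"
    using assms(3-8) by (elim insertE emptyE) auto
  then have "x = id \<or> x = \<rho> 1 \<or> x = \<sigma> \<or> x = \<sigma> \<circ> \<rho> 1 \<or> x = \<rho> 1 \<circ> \<sigma> \<or> x = \<rho> 1 \<circ> (\<sigma> \<circ> \<rho> 1)"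
  proof cases
    case 1
    then have "x = id" by (intro eqI) (auto simp: assms(9-11))
    then show ?thesis by blast
  next
    case 2
    then have "x = \<rho> 1" by (intro eqI) (auto simp: assms(9-11) \<rho>1[simplified])
    then show ?thesis by blast
  next
    case 3
    then have "x = \<sigma>" by (intro eqI) (auto simp: assms(9-11) \<sigma>_def)
    then show ?thesis by blast
  next
    case 4
    then have "x = \<sigma> \<circ> \<rho> 1" by (intro eqI) (auto simp: assms(9-11) \<rho>1[simplified] \<sigma>_def)
    then show ?thesis by blast
  next
    case 5
    then have "x = \<rho> 1 \<circ> \<sigma>" by (intro eqI) (auto simp: assms(9-11) \<rho>1[simplified] \<sigma>_def)
    then show ?thesis by blast
  next
    case 6
    then have "x = \<rho> 1 \<circ> (\<sigma> \<circ> \<rho> 1)" by (intro eqI) (auto simp: assms(9-11) \<rho>1[simplified] \<sigma>_def)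
    then show ?thesis by blast
  qed
  moreover have "\<rho> 1 \<in> W {1,2}" "\<sigma> \<in> W {1,2}" by (simp_all only: W_incl \<sigma>_W insert_iff simp_thms)
  ultimately show ?thesis using words_comp words.id by metis
qed

lemma W012_W123:
  assumes x012: "x \<in> W {0,1,2}" and x123: "x \<in> W {1,2,3}"
  shows "x \<in> W {1,2}"
proof -
  have x: "x 1 \<in> {1,2,3}" "x 2 \<in> {1,2,3}" "x 3 \<in> {1,2,3}"
    using W123_123[OF x123] by auto
  have "inj x" using W_bij[OF _ x012] by (simp add: bij_is_inj)
  then have neq: "x u = x v \<longleftrightarrow> u = v" for u v by (simp add: inj_eq)
  have d: "x 1 \<noteq> x 2" "x 1 \<noteq> x 3" "x 2 \<noteq> x 3" by (simp_all add: neq)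
  \<comment> \<open>An injection of {1,2,3} into itself is onto, so nothing from outside can
    enter.\<close>
  have out: "x v \<notin> {1,2,3}" if "v \<notin> {1,2,3}" for v
  proof
    have "card {x 1, x 2, x 3} = 3" using d by simp
    then have "{x 1, x 2, x 3} = {1,2,3}"
      using x by (intro card_subset_eq) auto
    moreover assume "x v \<in> {1,2,3}"
    ultimately have "x v \<in> {x 1, x 2, x 3}" by simp
    then show False using that neq[of v] by auto
  qed
  have "{1,2,4} \<in> design" "{1,3,5} \<in> design" "{2,3,6} \<in> design"
    by (simp_all add: design_def)
  then have T: "x ` {1,2,4} \<in> design" "x ` {1,3,5} \<in> design" "x ` {2,3,6} \<in> design"
    using W012_design[OF x012] by blast+
  have "x 4 = x 1 + x 2 + 1"
    by (rule design_third_point[OF T(1)]) (use x d out[of 4] in simp_all)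
  moreover have "x 5 = x 1 + x 3 + 1"
    by (rule design_third_point[OF T(2)]) (use x d out[of 5] in simp_all)
  moreover have "x 6 = x 2 + x 3 + 1"
    by (rule design_third_point[OF T(3)]) (use x d out[of 6] in simp_all)
  ultimately have x456: "x 4 = x 1 + x 2 + 1" "x 5 = x 1 + x 3 + 1" "x 6 = x 2 + x 3 + 1"
    by blast+
  show ?thesis
  proof (cases "\<forall>v \<ge> 7. x v = v")
    case True
    then show ?thesis using x d x456 W012_0[OF x012] by (intro W12_intro) auto
  next
    case False
    then have ge7: "\<And>v. 7 \<le> v \<Longrightarrow> x v = \<rho> 2 v" using W012_ge7[OF x012] by blast
    \<comment> \<open>\<open>\<rho> 2 \<circ> \<sigma>\<close> is the identity up to 6 and
      \<open>\<rho> 2\<close> beyond, so it removes the extra bit and leaves the six points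
      alone.\<close>
    define y where "y = \<rho> 2 \<circ> (\<sigma> \<circ> x)"
    have fixed: "\<rho> 2 (\<sigma> v) = v" if "v \<le> 6" for v
      using nat_le6_cases[of v] that n10 by (auto simp: \<rho>2 \<sigma>_def)
    have y_le6: "y v = x v" if "v \<le> 6" for v
      using fixed W012_le6[OF x012 that] by (simp add: y_def)
    have "\<sigma> v = v" if "7 \<le> v" for v using that by (auto simp: \<sigma>_def)
    then have "y v = v" if "7 \<le> v" for v
      using that ge7 \<rho>2_ge7[of v] \<rho>2_\<rho>2 by (simp add: y_def)
    then have "y \<in> W {1,2}"
      using x d x456 W012_0[OF x012] by (intro W12_intro) (auto simp: y_le6)
    moreover have "\<sigma> \<circ> (\<rho> 2 \<circ> y) = x"
      using \<rho>2_\<rho>2 by (auto simp: y_def fun_eq_iff \<sigma>_def)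
    moreover have "\<sigma> \<in> W {1,2}" "\<rho> 2 \<in> W {1,2}" by (simp_all only: W_incl \<sigma>_W insert_iff simp_thms)
    ultimately show ?thesis using words_comp by metis
  qed
qed

text \<open>Such an element keeps 5 and 6 within {5,6}, whose coordinates are 0 and 1. So
  \<open>k\<close> and \<open>s + k\<close> are 0 or 1 modulo \<open>m\<close>, which leaves only
  \<open>z \<mapsto> z\<close> and \<open>z \<mapsto> 1 - z\<close>.\<close>

lemma W23_W012:
  assumes x23: "x \<in> W {2,3}" and x012: "x \<in> W {0,1,2}"
  shows "x \<in> W {2}"
proof -
  obtain s k where x: "dih s k x" using W23_dih[OF x23] by blast
  have s: "s = 1 \<or> s = -1" using x unfolding dih_def by blast
  have "x 5 = 5 \<or> x 5 = 6" and "x 6 = 5 \<or> x 6 = 6"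
    using dih_5_6_7(1,3)[OF x] W012_le6[OF x012, of 5] W012_le6[OF x012, of 6] by auto
  then have k: "m dvd - k \<or> m dvd 1 - k" and sk: "m dvd - (s + k) \<or> m dvd 1 - (s + k)"
    using dih_5_6_7(2,4)[OF x] by (auto simp: \<psi>_5_6_7)
  show ?thesis
    using k
  proof
    assume k: "m dvd - k"
    then have "m dvd - (s + k) - (- k) \<or> m dvd 1 - (s + k) - (- k)"
      using sk by (blast intro: dvd_diff)
    then have "m dvd - s \<or> m dvd 1 - s" by simp
    moreover have "\<bar>- s\<bar> < 6" "\<bar>1 - s\<bar> < 6" using s by auto
    ultimately have "- s = 0 \<or> 1 - s = 0" using m_dvd_small by blast
    then have "s = 1" using s by auto
    then have "x = id" using dih_unique[OF _ dih_id] x k by simp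
    then show ?thesis using words.id by metis
  next
    assume k: "m dvd 1 - k"
    then have "m dvd - (s + k) - (1 - k) \<or> m dvd 1 - (s + k) - (1 - k)"
      using sk by (blast intro: dvd_diff)
    then have "m dvd - s - 1 \<or> m dvd - s" by simp
    moreover have "\<bar>- s - 1\<bar> < 6" "\<bar>- s\<bar> < 6" using s by auto
    ultimately have "- s - 1 = 0 \<or> - s = 0" using m_dvd_small by blast
    then have "s = -1" using s by auto
    moreover have "dih (-1) 1 (\<rho> 2)" using dih_\<rho>2[OF dih_id] by simp
    moreover have "m dvd k - 1" using k by (metis dvd_minus_iff minus_diff_eq)
    ultimately have "x = \<rho> 2" using dih_unique x by blast
    then show ?thesis using W_incl[of 2 "{2}"] by blast
  qed
qed

text \<open>The group generated by \<open>\<rho> 0\<close> and \<open>\<rho> 1\<close> is the symmetry group of this pentagon.\<close>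

definition pentagon :: "nat set set" where
  "pentagon = {{1,2},{2,4},{4,5},{3,5},{1,3}}"

lemma W01_pentagon: "x \<in> W {0,1} \<Longrightarrow> T \<in> pentagon \<Longrightarrow> x ` T \<in> pentagon"
proof (induction rule: W_induct)
  case (step i x)
  have "\<rho> i ` U \<in> pentagon" if "U \<in> pentagon" for U
    using that step(1) unfolding pentagon_def
    by (elim insertE emptyE) (simp_all add: \<rho>_values[simplified] insert_commute)
  then show ?case using step by (metis image_comp)
qed simp

text \<open>The pentagon is 1-2-4-5-3-1; within {1,2,3}, only 1 has two neighbours.\<close>

lemma pentagon_centre:
  assumes "{a,b} \<in> pentagon" "{a,c} \<in> pentagon" "b \<noteq> c" "a \<in> {1,2,3}" "b \<in> {1,2,3}" "c \<in> {1,2,3}"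
  shows "a = 1"
  using assms(4-6,1-3) by (elim insertE emptyE) (simp_all add: pentagon_def doubleton_eq_iff)

lemma pentagon_outer:
  assumes "{b,d} \<in> pentagon" "b = 2 \<or> b = 3" "d \<noteq> 1"
  shows "d = b + 2"
  using assms(2,1,3) by (elim disjE) (auto simp: pentagon_def doubleton_eq_iff)

text \<open>An element that also preserves {1,2,3} maps the path 2-1-3 to itself. It is the identity
  or the reflection of the pentagon that fixes 1, which is \<open>\<rho> 1\<close>.\<close>

lemma W01_W123:
  assumes x01: "x \<in> W {0,1}" and x123: "x \<in> W {1,2,3}"
  shows "x \<in> W {1}"
proof -
  have x: "x 1 \<in> {1,2,3}" "x 2 \<in> {1,2,3}" "x 3 \<in> {1,2,3}"
    using W123_123[OF x123] by auto
  have "inj x" using W_bij[OF _ x01] by (simp add: bij_is_inj)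
  then have neq: "x u = x v \<longleftrightarrow> u = v" for u v by (simp add: inj_eq)
  have d: "x 1 \<noteq> x 2" "x 1 \<noteq> x 3" "x 2 \<noteq> x 3" "x 1 \<noteq> x 4" "x 1 \<noteq> x 5" by (simp_all add: neq)
  have edge: "{x 1, x 2} \<in> pentagon" "{x 1, x 3} \<in> pentagon"
      "{x 2, x 4} \<in> pentagon" "{x 3, x 5} \<in> pentagon"
    using W01_pentagon[OF x01, of "{1,2}"] W01_pentagon[OF x01, of "{1,3}"]
      W01_pentagon[OF x01, of "{2,4}"] W01_pentagon[OF x01, of "{3,5}"]
    by (auto simp: pentagon_def)
  have x1: "x 1 = 1" by (rule pentagon_centre[OF edge(1,2) d(3) x])
  then have x23: "x 2 = 2 \<and> x 3 = 3 \<or> x 2 = 3 \<and> x 3 = 2"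
    using x(2,3) d(1-3) by (elim insertE emptyE) simp_all
  moreover have "x 4 = x 2 + 2" "x 5 = x 3 + 2"
    using pentagon_outer[OF edge(3)] pentagon_outer[OF edge(4)] x23 d(4,5) x1 by metis+
  ultimately have vals:
    "x 2 = 2 \<and> x 3 = 3 \<and> x 4 = 4 \<and> x 5 = 5 \<or> x 2 = 3 \<and> x 3 = 2 \<and> x 4 = 5 \<and> x 5 = 4"
    by (elim disjE) simp_all
  have out: "x v = v" if "v = 0 \<or> 6 \<le> v" for v using W01_fix[OF x01 that] .
  have cases: "v = 0 \<or> 6 \<le> v \<or> v = 1 \<or> v = 2 \<or> v = 3 \<or> v = 4 \<or> v = 5" for v :: nat
    by linarith
  from vals show ?thesis
  proof
    assume "x 2 = 2 \<and> x 3 = 3 \<and> x 4 = 4 \<and> x 5 = 5"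
    then have "x v = id v" for v using cases[of v] out x1 by (metis id_apply)
    then have "x = id" by blast
    then show ?thesis using words.id by metis
  next
    assume "x 2 = 3 \<and> x 3 = 2 \<and> x 4 = 5 \<and> x 5 = 4"
    then have "x v = \<rho> 1 v" for v using cases[of v] out x1 \<rho>_values \<rho>1_ge6 by metis
    then have "x = \<rho> 1" by blast
    then show ?thesis using W_incl[of 1 "{1}"] by blast
  qed
qed

section \<open>Combining the intersections of maximal parabolic subgroups\<close>

lemma drop_0:
  assumes "S \<subseteq> {2,3}" "x \<in> W (insert 0 S)" "x \<in> W {1,2,3}"
  shows "x \<in> W S"
proof -
  obtain y where y: "y \<in> W S" "x = y \<or> x = \<rho> 0 \<circ> y"
    using W_insert_cases[OF assms(2)] assms(1) by fastforce
  have "y \<in> W {1,2,3}" using y(1) W_mono[of S "{1,2,3}"] assms(1) by blast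
  \<comment> \<open>The alternative \<open>x = \<rho> 0 \<circ> y\<close> would put
    \<open>\<rho> 0\<close> into this group, but it sends 3 to 4.\<close>
  moreover have "\<rho> 0 \<notin> W {1,2,3}" using W123_123[of "\<rho> 0" 3] by (auto simp: \<rho>0)
  ultimately have "x \<noteq> \<rho> 0 \<circ> y" using W_quotient[of "{1,2,3}" "\<rho> 0" y] assms(3) by auto
  with y show ?thesis by blast
qed

lemma drop_3:
  assumes "S \<subseteq> {0,1}" "x \<in> W (insert 3 S)" "x \<in> W {0,1,2}"
  shows "x \<in> W S"
proof -
  obtain y where y: "y \<in> W S" "x = y \<or> x = \<rho> 3 \<circ> y"
    using W_insert_cases[OF assms(2)] assms(1) by fastforce
  have "y \<in> W {0,1,2}" using y(1) W_mono[of S "{0,1,2}"] assms(1) by blast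
  moreover have "\<rho> 3 \<notin> W {0,1,2}" using W012_le6[of "\<rho> 3" 6] n10 by (auto simp: \<rho>3)
  ultimately have "x \<noteq> \<rho> 3 \<circ> y" using W_quotient[of "{0,1,2}" "\<rho> 3" y] assms(3) by auto
  with y show ?thesis by blast
qed

lemma \<rho>0_cancel: "\<rho> 0 \<circ> (\<rho> 0 \<circ> x) = x" and \<rho>3_cancel: "\<rho> 3 \<circ> (\<rho> 3 \<circ> x) = x"
  using \<rho>_invol[of 0] \<rho>_invol[of 3] by (simp_all flip: comp_assoc)

lemma insert_3: "{0,1,3::nat} = insert 3 {0,1}"
  by auto

text \<open>\<open>\<rho> 3\<close> lies in both groups, so it can be split off, and put back once
  \<open>W01_W123\<close> has been applied to the rest.\<close>

lemma W013_W123: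
  assumes "x \<in> W {0,1,3}" "x \<in> W {1,2,3}"
  shows "x \<in> W {1,3}"
proof -
  obtain y where y: "y \<in> W {0,1}" "x = y \<or> x = \<rho> 3 \<circ> y"
    using W_insert_cases[OF assms(1)[unfolded insert_3]] by fastforce
  have r3: "\<rho> 3 \<in> W {1,2,3}" "\<rho> 3 \<in> W {1,3}" by (simp_all only: W_incl insert_iff simp_thms)
  have "y = x \<or> y = \<rho> 3 \<circ> x"
    using y(2) \<rho>3_cancel by metis
  then have "y \<in> W {1,2,3}" using assms(2) r3 words_comp by metis
  then have "y \<in> W {1,3}" using W01_W123[OF y(1)] W_mono[of "{1}" "{1,3}"] by blast
  then show ?thesis using y(2) r3 words_comp by metis
qed

lemma W023_W012:
  assumes "x \<in> W {0,2,3}" "x \<in> W {0,1,2}"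
  shows "x \<in> W {0,2}"
proof -
  obtain y where y: "y \<in> W {2,3}" "x = y \<or> x = \<rho> 0 \<circ> y"
    using W_insert_cases[OF assms(1)] by fastforce
  have r0: "\<rho> 0 \<in> W {0,1,2}" "\<rho> 0 \<in> W {0,2}" by (simp_all only: W_incl insert_iff simp_thms)
  have "y = x \<or> y = \<rho> 0 \<circ> x"
    using y(2) \<rho>0_cancel by metis
  then have "y \<in> W {0,1,2}" using assms(2) r0 words_comp by metis
  then have "y \<in> W {0,2}" using W23_W012[OF y(1)] W_mono[of "{2}" "{0,2}"] by blast
  then show ?thesis using y(2) r0 words_comp by metis
qed

text \<open>\<open>\<rho> 0\<close> and \<open>\<rho> 3\<close> are split off in turn; what remains
  lies in \<open>W {0,1}\<close> and in \<open>W {2,3}\<close>, so it is trivial.\<close>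

lemma W023_W013:
  assumes "x \<in> W {0,2,3}" "x \<in> W {0,1,3}"
  shows "x \<in> W {0,3}"
proof -
  obtain y where y: "y \<in> W {2,3}" "x = y \<or> x = \<rho> 0 \<circ> y"
    using W_insert_cases[OF assms(1)] by fastforce
  have r0: "\<rho> 0 \<in> W {0,1,3}" "\<rho> 0 \<in> W {0,3}" by (simp_all only: W_incl insert_iff simp_thms)
  have r3: "\<rho> 3 \<in> W {2,3}" "\<rho> 3 \<in> W {0,3}" by (simp_all only: W_incl insert_iff simp_thms)
  have "y = x \<or> y = \<rho> 0 \<circ> x"
    using y(2) \<rho>0_cancel by metis
  then have "y \<in> W {0,1,3}" using assms(2) r0 words_comp by metis
  then obtain z where z: "z \<in> W {0,1}" "y = z \<or> y = \<rho> 3 \<circ> z"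
    using W_insert_cases[of y 3 "{0,1}"] unfolding insert_3 by fastforce
  then have "z = y \<or> z = \<rho> 3 \<circ> y"
    using \<rho>3_cancel by metis
  then have "z \<in> W {2,3}" using y(1) r3 words_comp by metis
  then have "z = id" using W01_W23[OF z(1)] by blast
  then have "y \<in> W {0,3}" using z(2) r3 words.id by (metis comp_id)
  then show ?thesis using y(2) r0 words_comp by metis
qed

text \<open>Two omitted indices are settled by the pairwise intersections; each further one is
  removed by \<open>drop_0\<close> or \<open>drop_3\<close>.\<close>

lemma Int_maximal_parabolics:
  assumes J: "J \<subseteq> {0,1,2,3}" and x: "x \<in> W {0,1,2,3}"
    and x0: "0 \<notin> J \<Longrightarrow> x \<in> W {1,2,3}" and x1: "1 \<notin> J \<Longrightarrow> x \<in> W {0,2,3}"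
    and x2: "2 \<notin> J \<Longrightarrow> x \<in> W {0,1,3}" and x3: "3 \<notin> J \<Longrightarrow> x \<in> W {0,1,2}"
  shows "x \<in> W J"
proof -
  have a01: "0 \<notin> J \<Longrightarrow> 1 \<notin> J \<Longrightarrow> x \<in> W {2,3}"
    using drop_0[of "{2,3}" x] x0 x1 by blast
  have a02: "0 \<notin> J \<Longrightarrow> 2 \<notin> J \<Longrightarrow> x \<in> W {1,3}"
    using W013_W123 x0 x2 by blast
  have a03: "0 \<notin> J \<Longrightarrow> 3 \<notin> J \<Longrightarrow> x \<in> W {1,2}"
    using W012_W123 x0 x3 by blast
  have a12: "1 \<notin> J \<Longrightarrow> 2 \<notin> J \<Longrightarrow> x \<in> W {0,3}"
    using W023_W013 x1 x2 by blast
  have a13: "1 \<notin> J \<Longrightarrow> 3 \<notin> J \<Longrightarrow> x \<in> W {0,2}"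
    using W023_W012 x1 x3 by blast
  have a23: "2 \<notin> J \<Longrightarrow> 3 \<notin> J \<Longrightarrow> x \<in> W {0,1}"
    using drop_3[of "{0,1}" x, folded insert_3] x2 x3 by blast
  have a012: "0 \<notin> J \<Longrightarrow> 1 \<notin> J \<Longrightarrow> 2 \<notin> J \<Longrightarrow> x \<in> W {3}"
    using drop_0[of "{3}" x] x0 a12 by blast
  have a013: "0 \<notin> J \<Longrightarrow> 1 \<notin> J \<Longrightarrow> 3 \<notin> J \<Longrightarrow> x \<in> W {2}"
    using drop_0[of "{2}" x] x0 a13 by blast
  have a023: "0 \<notin> J \<Longrightarrow> 2 \<notin> J \<Longrightarrow> 3 \<notin> J \<Longrightarrow> x \<in> W {1}"
    using drop_3[of "{1}" x, unfolded insert_commute[of 3 1 "{}"]] x3 a02 by blast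
  have a123: "1 \<notin> J \<Longrightarrow> 2 \<notin> J \<Longrightarrow> 3 \<notin> J \<Longrightarrow> x \<in> W {0}"
    using drop_3[of "{0}" x, unfolded insert_commute[of 3 0 "{}"]] x3 a12 by blast
  have a0123: "0 \<notin> J \<Longrightarrow> 1 \<notin> J \<Longrightarrow> 2 \<notin> J \<Longrightarrow> 3 \<notin> J \<Longrightarrow> x \<in> W {}"
    using drop_0[of "{}" x] x0 a123 by blast
  have J_eq: "J = (if 0 \<in> J then {0} else {}) \<union> (if 1 \<in> J then {1} else {})
      \<union> (if 2 \<in> J then {2} else {}) \<union> (if 3 \<in> J then {3} else {})"
    using J by auto
  show ?thesis
    using x x0 x1 x2 x3 a01 a02 a03 a12 a13 a23 a012 a013 a023 a123 a0123
    by (subst J_eq, cases "0 \<in> J"; cases "1 \<in> J"; cases "2 \<in> J"; cases "3 \<in> J")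
      (simp_all only: simp_thms if_True if_False Un_empty_left Un_empty_right Un_insert_left)
qed

text \<open>An index missing from \<open>J \<inter> K\<close> is missing from \<open>J\<close> or
  from \<open>K\<close>, so the element lies in the maximal parabolic subgroup omitting it.\<close>

lemma W_Int:
  assumes "J \<subseteq> {0,1,2,3}" "K \<subseteq> {0,1,2,3}"
  shows "W J \<inter> W K = W (J \<inter> K)"
proof
  show "W (J \<inter> K) \<subseteq> W J \<inter> W K" using W_mono[of "J \<inter> K"] by blast
  show "W J \<inter> W K \<subseteq> W (J \<inter> K)"
  proof
    fix x assume x: "x \<in> W J \<inter> W K"
    have max: "x \<in> W L" if "J \<subseteq> L \<or> K \<subseteq> L" for L
      using x that W_mono by blast
    show "x \<in> W (J \<inter> K)"
    proof (rule Int_maximal_parabolics)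
      show "J \<inter> K \<subseteq> {0,1,2,3}" "x \<in> W {0,1,2,3}" using assms max by blast+
      show "0 \<notin> J \<inter> K \<Longrightarrow> x \<in> W {1,2,3}" "1 \<notin> J \<inter> K \<Longrightarrow> x \<in> W {0,2,3}"
        "2 \<notin> J \<inter> K \<Longrightarrow> x \<in> W {0,1,3}" "3 \<notin> J \<inter> K \<Longrightarrow> x \<in> W {0,1,2}"
        by (rule max, use assms in blast)+
    qed
  qed
qed

section \<open>The generated group is alternating\<close>

definition tri :: "nat \<Rightarrow> nat \<Rightarrow> nat \<Rightarrow> bool" where
  "tri a b c \<longleftrightarrow> distinct [a,b,c] \<and> cycle_of_list [a,b,c] \<in> W {0,1,2,3}"

lemma tri_conj: assumes "tri a b c" "g \<in> W {0,1,2,3}" shows "tri (g a) (g b) (g c)"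
proof -
  have J: "{0,1,2,3} \<subseteq> {..<4::nat}" by auto
  have "bij g" using W_bij[OF J assms(2)] .
  moreover have "inv' g \<in> W {0,1,2,3}" using words_inv[OF assms(2) W_invol[OF J]] .
  ultimately have "cycle_of_list (map g [a,b,c]) \<in> W {0,1,2,3}"
    using assms conjugation_of_cycle[of "[a,b,c]" g] words_comp unfolding tri_def by metis
  moreover have "distinct (map g [a,b,c])"
    using assms(1) \<open>bij g\<close> unfolding tri_def by (auto simp: bij_is_inj inj_eq)
  ultimately show ?thesis by (simp add: tri_def)
qed

lemma tri_\<rho>: "tri a b c \<Longrightarrow> i \<in> {0,1,2,3} \<Longrightarrow> tri (\<rho> i a) (\<rho> i b) (\<rho> i c)"
  by (rule tri_conj[OF _ W_incl])

lemma tri_rotate: assumes "tri a b c" shows "tri b c a"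
proof -
  have d: "a \<noteq> b" "b \<noteq> c" "a \<noteq> c" using assms by (simp_all add: tri_def)
  have "cycle_of_list [a,b,c] v = cycle_of_list [b,c,a] v" for v
    by (cases "v = a"; cases "v = b"; cases "v = c") (use d in \<open>simp_all add: transpose_def\<close>)
  then have "cycle_of_list [a,b,c] = cycle_of_list [b,c,a]" by blast
  then show ?thesis using assms by (auto simp only: tri_def distinct.simps list.set)
qed

text \<open>The square of a 3-cycle is its inverse. Together with \<open>tri_rotate\<close> this
  makes the order of the arguments irrelevant.\<close>

lemma tri_swap: assumes "tri a b c" shows "tri b a c"
proof -
  have d: "a \<noteq> b" "b \<noteq> c" "a \<noteq> c" using assms by (simp_all add: tri_def)
  have "(cycle_of_list [a,b,c] \<circ> cycle_of_list [a,b,c]) v = cycle_of_list [b,a,c] v" for v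
    by (cases "v = a"; cases "v = b"; cases "v = c") (use d in \<open>simp_all add: transpose_def\<close>)
  then have "cycle_of_list [a,b,c] \<circ> cycle_of_list [a,b,c] = cycle_of_list [b,a,c]" by blast
  then have "cycle_of_list [b,a,c] \<in> W {0,1,2,3}"
    using words_comp assms unfolding tri_def by metis
  moreover have "distinct [b,a,c]" using d by simp
  ultimately show ?thesis unfolding tri_def by blast
qed

lemma tri_conj_cycle:
  assumes "tri a b c" "tri x y z"
  shows "tri (cycle_of_list [x,y,z] a) (cycle_of_list [x,y,z] b) (cycle_of_list [x,y,z] c)"
  by (rule tri_conj[OF assms(1)]) (use assms(2) in \<open>simp only: tri_def\<close>)

text \<open>Conjugation of (a b x) by (x y z), which fixes a and b and sends x to y.\<close>

lemma tri_subst: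
  assumes "tri a b x" "tri x y z" "a \<notin> {x,y,z}" "b \<notin> {x,y,z}"
  shows "tri a b y"
proof -
  have "x \<noteq> y" "y \<noteq> z" "x \<noteq> z" using assms(2) by (simp_all add: tri_def)
  then have "cycle_of_list [x,y,z] a = a" "cycle_of_list [x,y,z] b = b" "cycle_of_list [x,y,z] x = y"
    using assms(3,4) by (simp_all add: transpose_def)
  then show ?thesis using tri_conj_cycle[OF assms(1,2)] by metis
qed

text \<open>The supports of \<open>\<sigma>\<close> and \<open>\<rho> 3\<close> share only the point 6, so that their commutator is a 3-cycle.\<close>

lemma tri_657: "tri 6 5 7"
proof -
  have "\<sigma> \<circ> (\<rho> 3 \<circ> (\<sigma> \<circ> \<rho> 3)) = cycle_of_list [6,5,7]"
  proof
    fix v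
    have big: "\<rho> 3 v \<ge> 8" if "v \<ge> 8"
      using that by (cases "v = 8") (auto simp: \<rho>3)
    consider "v < 5" | "v = 5" | "v = 6" | "v = 7" | "v \<ge> 8" by linarith
    then show "(\<sigma> \<circ> (\<rho> 3 \<circ> (\<sigma> \<circ> \<rho> 3))) v = cycle_of_list [6,5,7] v"
    proof cases
      case 1
      then have "\<rho> 3 v = v" "\<sigma> v < 5" "\<sigma> (\<sigma> v) = v" by (auto simp: \<rho>3 \<sigma>_def)
      moreover from this have "\<rho> 3 (\<sigma> v) = \<sigma> v" by (simp add: \<rho>3)
      ultimately show ?thesis using 1 by (simp add: transpose_def)
    next
      case 5
      then have "\<sigma> (\<rho> 3 v) = \<rho> 3 v" "\<sigma> v = v" using big by (auto simp: \<sigma>_def)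
      then show ?thesis using 5 by (simp add: \<rho>3_\<rho>3 transpose_def)
    qed (use n10 in \<open>auto simp: \<rho>3 \<sigma>_def transpose_def\<close>)
  qed
  moreover have "\<sigma> \<in> W {0,1,2,3}" "\<rho> 3 \<in> W {0,1,2,3}"
    by (simp_all only: W_incl \<sigma>_W insert_iff simp_thms)
  ultimately show ?thesis using words_comp unfolding tri_def by (metis distinct_length_2_or_more
    distinct_singleton numeral_eq_iff semiring_norm(88) semiring_norm(90) semiring_norm(89))
qed

lemma tri_67:
  shows "tri 6 4 7" "tri 6 3 7"
proof -
  show "tri 6 4 7"
    using tri_\<rho>[OF tri_657, of 1] by (simp add: \<rho>1[simplified])
  then show "tri 6 3 7"
    using tri_\<rho>[of 6 4 7 0] by (simp add: \<rho>0)
qed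

text \<open>The point 7 has to stay put throughout, so \<open>\<sigma>\<close> takes the place of
  \<open>\<rho> 2\<close>, which would send 7 to 8.\<close>

lemma tri_12_7: "tri 1 2 7"
proof -
  have "\<sigma> \<in> W {0,1,2,3}" by (simp_all only: \<sigma>_W insert_iff simp_thms)
  from tri_conj[OF tri_67(2) this] have "tri 5 3 7" by (simp add: \<sigma>_def)
  from tri_\<rho>[OF this, of 1] have "tri 4 2 7" by (simp add: \<rho>1[simplified])
  from tri_\<rho>[OF this, of 0] have "tri 3 1 7" by (simp add: \<rho>0)
  from tri_\<rho>[OF this, of 1] have "tri 2 1 7" by (simp add: \<rho>1[simplified])
  then show ?thesis by (rule tri_swap)
qed

text \<open>The label of {w,w+1} decides which generator pushes \<open>w\<close> on.
  \<open>\<rho> 2\<close> exchanges 1 and 2 on the way, and \<open>tri_swap\<close> repairs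
  this.\<close>

lemma tri_12_ge7: "7 \<le> w \<Longrightarrow> w \<le> n \<Longrightarrow> tri 1 2 w"
proof (induction w rule: nat_induct_at_least)
  case base
  show ?case by (rule tri_12_7)
next
  case (Suc w)
  then have IH: "tri 1 2 w" by simp
  show ?case
  proof (cases "odd w")
    case True
    then have "\<rho> 2 w = Suc w" using Suc by (auto simp: \<rho>2)
    then have "tri 2 1 (Suc w)" using tri_\<rho>[OF IH, of 2] \<rho>_values by simp
    then show ?thesis by (rule tri_swap)
  next
    case False
    then have "\<rho> 3 w = Suc w" using Suc by (auto simp: \<rho>3)
    moreover have "\<rho> 3 1 = 1" "\<rho> 3 2 = 2" by (simp_all add: \<rho>3)
    ultimately show ?thesis using tri_\<rho>[OF IH, of 3] by simp
  qed
qed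

lemma tri_12:
  assumes "3 \<le> w" "w \<le> n"
  shows "tri 1 2 w"
proof -
  have "\<rho> 3 1 = 1" "\<rho> 3 2 = 2" "\<rho> 3 7 = 6" using n10 by (simp_all add: \<rho>3)
  then have t6: "tri 1 2 6" using tri_\<rho>[OF tri_12_7, of 3] by simp
  have "tri 1 2 5" by (rule tri_subst[OF t6 tri_657]) auto
  moreover have "tri 1 2 4" by (rule tri_subst[OF t6 tri_67(1)]) auto
  moreover have "tri 1 2 3" by (rule tri_subst[OF t6 tri_67(2)]) auto
  moreover have "w = 3 \<or> w = 4 \<or> w = 5 \<or> w = 6 \<or> 7 \<le> w" using assms(1) by linarith
  ultimately show ?thesis using t6 tri_12_ge7 assms(2) by blast
qed

lemma tri_1:
  assumes "2 \<le> x" "x \<le> n" "2 \<le> y" "y \<le> n" "x \<noteq> y"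
  shows "tri 1 x y"
proof -
  consider "x = 2" | "y = 2" | "3 \<le> x" "3 \<le> y" using assms by linarith
  then show ?thesis
  proof cases
    case 1
    then show ?thesis using tri_12[of y] assms by simp
  next
    case 2
    then have "tri 1 2 x" using tri_12[of x] assms by simp
    then show ?thesis using 2 tri_swap tri_rotate by blast
  next
    case 3
    then have t: "tri 1 2 x" "tri 1 2 y" using tri_12 assms by blast+
    \<comment> \<open>The conjugating cycle sends 2 to 1 and 1 to y and fixes x.\<close>
    from t(1) tri_swap[OF t(2)] have "tri (cycle_of_list [2,1,y] 1) (cycle_of_list [2,1,y] 2) (cycle_of_list [2,1,y] x)"
      by (rule tri_conj_cycle)
    then have "tri y 1 x"
      using 3 assms(5) by (simp add: transpose_def)
    then show ?thesis by (rule tri_rotate)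
  qed
qed

lemma tri_all:
  assumes "distinct [a,b,c]" "{a,b,c} \<subseteq> {1..n}"
  shows "tri a b c"
proof -
  consider "a = 1" | "b = 1" | "c = 1" | "2 \<le> a" "2 \<le> b" "2 \<le> c" using assms(2) by fastforce
  then show ?thesis
  proof cases
    case 1
    then show ?thesis using tri_1[of b c] assms by auto
  next
    case 2
    then have "tri 1 c a" using tri_1[of c a] assms by auto
    then show ?thesis using 2 tri_rotate by blast
  next
    case 3
    then have "tri 1 a b" using tri_1[of a b] assms by auto
    then show ?thesis using 3 tri_rotate by blast
  next
    case 4
    \<comment> \<open>Four candidates for \<open>w\<close> against three forbidden points. The cycle
      (1 c w) then sends 1 to c and fixes a and b.\<close>
    have "card {a,b,c} < card {2,3,4,5::nat}"
      using card_insert_le_m1[of 3 "{b,c}" a] card_insert_le_m1[of 2 "{c}" b] by simp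
    then obtain w where w: "w \<in> {2,3,4,5}" "w \<notin> {a,b,c}"
      by (metis card_mono finite.emptyI finite_insert linorder_not_le subsetI)
    then have "tri 1 a b" "tri 1 c w" using tri_1[of a b] tri_1[of c w] assms 4 n10 by auto
    then have "tri (cycle_of_list [1,c,w] 1) (cycle_of_list [1,c,w] a) (cycle_of_list [1,c,w] b)"
      by (rule tri_conj_cycle)
    then have "tri c a b"
      using 4 w assms(1) by (auto simp: transpose_def split: if_splits)
    then show ?thesis by (rule tri_rotate)
  qed
qed

lemma W_alt: "W {0,1,2,3} = carrier (alt_group n)"
proof
  show "W {0,1,2,3} \<subseteq> carrier (alt_group n)"
  proof
    fix x assume "x \<in> W {0,1,2,3}"
    then show "x \<in> carrier (alt_group n)"
    proof (induction rule: W_induct)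
      case id
      show ?case by (metis alt_group_is_group alt_group_one group.is_monoid monoid.one_closed)
    next
      case (step i x)
      then have "i < 4" by auto
      then have "\<rho> i \<in> carrier (alt_group n)"
        using \<rho>_permutes \<rho>_even by (simp add: alt_group_carrier)
      then show ?case
        using step by (metis alt_group_is_group alt_group_mult group.is_monoid monoid.m_closed)
    qed
  qed
  show "carrier (alt_group n) \<subseteq> W {0,1,2,3}"
  proof
    have three: "h \<in> W {0,1,2,3}" if h: "h \<in> three_cycles n" for h
    proof -
      obtain cs where cs: "h = cycle_of_list cs" "distinct cs" "length cs = 3" "set cs \<subseteq> {1..n}"
        using h by blast
      obtain a b c where "cs = [a,b,c]" using stupid_lemma[OF cs(3)] by blast
      then show ?thesis using tri_all[of a b c] cs by (simp add: tri_def)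
    qed
    fix x assume "x \<in> carrier (alt_group n)"
    then have "x \<in> generate (alt_group n) (three_cycles n)"
      using alt_group_carrier_as_three_cycles by blast
    then show "x \<in> W {0,1,2,3}"
    proof (induction rule: generate.induct)
      case one
      show ?case by (metis alt_group_one words.id)
    next
      case (incl h)
      then show ?case by (rule three)
    next
      case (inv h)
      have "inv\<^bsub>alt_group n\<^esub> h = inv' h"
        using inv three_cycles_incl by (intro alt_group_inv_equality) blast
      moreover have "{0,1,2,3} \<subseteq> {..<4::nat}" by auto
      ultimately show ?case using words_inv[OF three[OF inv] W_invol[of "{0,1,2,3}"]] by metis
    next
      case (eng h1 h2)
      then show ?case by (metis alt_group_mult words_comp)
    qed
  qed
qed

section \<open>Orders of the products of consecutive generators\<close>

text \<open>Negation followed by \<open>z \<mapsto> 1 - z\<close> is translation by 1, so the order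
  of the product is the modulus.\<close>

lemma dih_rotation: "dih 1 (int j) ((\<rho> 2 \<circ> \<rho> 3) ^^ j)"
proof (induction j)
  case 0
  show ?case using dih_id by (simp only: funpow.simps of_nat_0)
next
  case (Suc j)
  have "dih 1 (int (Suc j)) (\<rho> 2 \<circ> (\<rho> 3 \<circ> (\<rho> 2 \<circ> \<rho> 3) ^^ j))"
    using dih_\<rho>2[OF dih_\<rho>3[OF Suc]] by (simp only: minus_minus diff_minus_eq_add of_nat_Suc)
  then show ?case by (simp only: funpow.simps comp_assoc)
qed

lemma order_23: "(\<rho> 2 \<circ> \<rho> 3) ^^ j = id \<longleftrightarrow> n - 4 dvd j"
proof
  have m: "m = int (n - 4)" using n10 by simp
  show "n - 4 dvd j" if "(\<rho> 2 \<circ> \<rho> 3) ^^ j = id"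
    using dih_5_6_7(2)[OF dih_rotation[of j]] that by (simp add: \<psi>_5_6_7 m)
  show "(\<rho> 2 \<circ> \<rho> 3) ^^ j = id" if "n - 4 dvd j"
    using dih_unique[OF dih_rotation dih_id, of j] that by (simp add: m)
qed

lemma funpow_eq_id_iff_dvd:
  fixes f :: "'a \<Rightarrow> 'a"
  assumes "0 < d" "f ^^ d = id" "\<And>r. 0 < r \<Longrightarrow> r < d \<Longrightarrow> f ^^ r \<noteq> id"
  shows "f ^^ j = id \<longleftrightarrow> d dvd j"
proof -
  have "f ^^ j = (f ^^ d) ^^ (j div d) \<circ> f ^^ (j mod d)"
    by (simp only: funpow_mult flip: funpow_add) simp
  then have "f ^^ j = f ^^ (j mod d)" using assms(2) by (simp only: id_funpow id_comp)
  then show ?thesis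
    using assms(1) assms(3)[of "j mod d"] by (cases "j mod d = 0") (auto simp: dvd_eq_mod_eq_0 id_def)
qed

lemma funpow_steps:
  "(f ^^ 1) x = f x" "(f ^^ 2) x = f (f x)" "(f ^^ 3) x = f (f (f x))" "(f ^^ 4) x = f (f (f (f x)))"
  "(f ^^ 5) x = f (f (f (f (f x))))" "(f ^^ 6) x = f (f (f (f (f (f x)))))"
  by (simp_all add: numeral_eq_Suc)

lemma order_01: "(\<rho> 0 \<circ> \<rho> 1) ^^ j = id \<longleftrightarrow> 5 dvd j"
proof (rule funpow_eq_id_iff_dvd)
  show "(\<rho> 0 \<circ> \<rho> 1) ^^ 5 = id"
  proof
    fix v
    have "\<rho> 0 v = v" "\<rho> 1 v = v" if "7 \<le> v" using that by (simp_all add: \<rho>0 \<rho>1[simplified])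
    then show "((\<rho> 0 \<circ> \<rho> 1) ^^ 5) v = id v"
      unfolding funpow_steps comp_apply using nat_le6_cases[of v] by (elim disjE) (simp_all add: \<rho>_values[simplified])
  qed
  show "(\<rho> 0 \<circ> \<rho> 1) ^^ r \<noteq> id" if "0 < r" "r < 5" for r
  proof -
    have "r = 1 \<or> r = 2 \<or> r = 3 \<or> r = 4" using that by linarith
    then have "((\<rho> 0 \<circ> \<rho> 1) ^^ r) 1 \<noteq> 1"
      by (elim disjE) (simp_all only: funpow_steps comp_apply, simp_all add: \<rho>_values[simplified])
    then show ?thesis by (metis id_apply)
  qed
qed simp

lemma order_12: "(\<rho> 1 \<circ> \<rho> 2) ^^ j = id \<longleftrightarrow> 6 dvd j"
proof (rule funpow_eq_id_iff_dvd)
  have ge7: "\<rho> 1 v = v" "\<rho> 1 (\<rho> 2 v) = \<rho> 2 v" if "7 \<le> v" for v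
    using \<rho>1_ge6 \<rho>2_ge7[OF that] that by simp_all
  show "(\<rho> 1 \<circ> \<rho> 2) ^^ 6 = id"
  proof
    fix v
    show "((\<rho> 1 \<circ> \<rho> 2) ^^ 6) v = id v"
      unfolding funpow_steps comp_apply using nat_le6_cases[of v]
      by (elim disjE) (simp_all add: \<rho>_values[simplified] ge7[simplified] \<rho>2_\<rho>2)
  qed
  show "(\<rho> 1 \<circ> \<rho> 2) ^^ r \<noteq> id" if "0 < r" "r < 6" for r
  proof -
    have "r = 1 \<or> r = 2 \<or> r = 3 \<or> r = 4 \<or> r = 5" using that by linarith
    moreover have "\<rho> 2 7 = 8" "\<rho> 2 8 = 7" using n10 by (simp_all add: \<rho>2)
    \<comment> \<open>The vertex 1 lies on a 3-cycle of the product and 7 on a 2-cycle, so no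
      positive exponent below 6 fixes both.\<close>
    ultimately have "((\<rho> 1 \<circ> \<rho> 2) ^^ r) 1 \<noteq> 1 \<or> ((\<rho> 1 \<circ> \<rho> 2) ^^ r) 7 \<noteq> 7"
      by (elim disjE) (simp_all only: funpow_steps comp_apply, simp_all add: \<rho>_values[simplified] \<rho>1_ge6[simplified])
    then show ?thesis by (metis id_apply)
  qed
qed simp

end

section \<open>Transfer to the abstract notions of group, string C-group and order\<close>

theorem theorem4p2:
  fixes n :: nat
  assumes "n \<ge> 10" and "n mod 4 = 2"
  defines "rs \<equiv> map (rho_lab (path_graph_4p2 n)) [0..<4]"
  defines "G \<equiv> perm_gen_group n rs"
  shows "G \<cong> alt_group n \<and> string_C_group G rs \<and> length rs = 4
         \<and> schlafli_type G rs = [5, 6, n - 4]"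
proof -
  interpret path_4p2 n using assms(1,2) by unfold_locales
  have nth: "rs ! i = \<rho> i" if "i < 4" for i using that by (simp add: rs_def)
  have len: "length rs = 4" by (simp add: rs_def)
  have lt4: "{..<4::nat} = {0,1,2,3}" by auto
  have set: "set rs = \<rho> ` {0,1,2,3}"
    unfolding rs_def set_map set_upt atLeast0LessThan lt4 ..
  have "\<rho> ` {0,1,2,3} \<subseteq> carrier (sym_group n)"
    using \<rho>_permutes unfolding lt4[symmetric] by (auto simp: sym_group_carrier)
  then have "generate (sym_group n) (set rs) = carrier (alt_group n)"
    unfolding set using generate_eq_words[OF sym_group_is_group sym_group_mult sym_group_one] W_invol lt4 W_alt
    by (metis order_refl)
  \<comment> \<open>This is an equality and not only an isomorphism: \<open>alt_group n\<close> too
    is \<open>sym_group n\<close> with its carrier replaced.\<close>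
  then have G: "G = alt_group n"
    by (simp add: G_def perm_gen_group_def alt_group_def)
  interpret group G unfolding G by (rule alt_group_is_group)
  have mult: "mult G = (\<circ>)" and one: "one G = id"
    unfolding G by (rule alt_group_mult, rule alt_group_one)
  have carr: "\<rho> i \<in> carrier G" if "i < 4" for i
    unfolding G using \<rho>_permutes[OF that] \<rho>_even[OF that] by (simp add: alt_group_carrier)
  have gen: "generate G ((!) rs ` J) = W J" if "J \<subseteq> {..<4}" for J
  proof -
    have "(!) rs ` J = \<rho> ` J" using nth that by (intro image_cong) auto
    moreover have "\<rho> ` J \<subseteq> carrier G" using carr that by blast
    ultimately show ?thesis
      using generate_eq_words[OF is_group mult one] W_invol[OF that] by metis
  qed
  have moved: "\<rho> 0 1 \<noteq> 1" "\<rho> 1 2 \<noteq> 2" "\<rho> 2 1 \<noteq> 1" "\<rho> 3 6 \<noteq> 6"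
    using n10 by (simp_all add: \<rho>0 \<rho>1[simplified] \<rho>2 \<rho>3)
  have ne: "\<rho> i \<noteq> id" if "i < 4" for i
    using less_4_cases[OF that] moved by (metis id_apply)
  have commute: "(\<rho> i \<circ> \<rho> j) \<circ> (\<rho> i \<circ> \<rho> j) = id" if "i < 4" "j < 4" "i + 2 \<le> j \<or> j + 2 \<le> i" for i j
  proof -
    have "\<rho> i \<circ> \<rho> j = \<rho> j \<circ> \<rho> i" using that \<rho>_commute by metis
    then show ?thesis using \<rho>_invol[OF that(1)] \<rho>_invol[OF that(2)] by (metis comp_assoc comp_id)
  qed
  have pow2: "x [^]\<^bsub>G\<^esub> (2::nat) = x \<circ> x" if "x \<in> carrier G" for x
    using that by (simp only: numeral_2_eq_2 nat_pow_Suc nat_pow_0 mult one id_comp)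
  have sggi: "sggi G rs"
    unfolding sggi_def len
  proof (intro conjI allI impI)
    have "(!) rs ` {..<4} = set rs" using len by (auto simp: set_conv_nth)
    then show "generate G (set rs) = carrier G"
      using gen[of "{..<4}"] W_alt G lt4 by (metis order_refl)
    fix i assume i: "i < (4::nat)"
    show "rs ! i \<in> carrier G" "rs ! i \<noteq> \<one>\<^bsub>G\<^esub>" "rs ! i \<otimes>\<^bsub>G\<^esub> rs ! i = \<one>\<^bsub>G\<^esub>"
      using nth[OF i] carr[OF i] ne[OF i] \<rho>_invol[OF i] by (simp_all only: mult one simp_thms)
    fix j assume j: "j < (4::nat)" "i + 2 \<le> j \<or> j + 2 \<le> i"
    have "\<rho> i \<circ> \<rho> j \<in> carrier G" using m_closed[OF carr[OF i] carr[OF j(1)]] mult by metis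
    then show "(rs ! i \<otimes>\<^bsub>G\<^esub> rs ! j) [^]\<^bsub>G\<^esub> (2::nat) = \<one>\<^bsub>G\<^esub>"
      using pow2 commute[OF i j] nth[OF i] nth[OF j(1)] mult one by metis
  qed (rule is_group)
  have "string_C_group G rs"
    unfolding string_C_group_def len
  proof (intro conjI allI impI sggi)
    fix J K :: "nat set"
    assume "J \<subseteq> {..<4}" "K \<subseteq> {..<4}"
    then show "generate G ((!) rs ` J) \<inter> generate G ((!) rs ` K) = generate G ((!) rs ` (J \<inter> K))"
      using gen W_Int[of J K] lt4 by (metis inf.coboundedI1)
  qed
  moreover have ord: "ord x = d" if "x \<in> carrier G" "\<And>j. x ^^ j = id \<longleftrightarrow> d dvd j" for x d
  proof -
    have "x [^]\<^bsub>G\<^esub> j = x ^^ j" for j :: nat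
      by (induction j) (simp_all only: funpow.simps(1) nat_pow_0 one funpow_Suc_right mult nat_pow_Suc)
    then show ?thesis using that ord_unique[OF that(1)] one by metis
  qed
  have "schlafli_type G rs = [5, 6, n - 4]"
  proof -
    have "schlafli_type G rs = [ord (\<rho> 0 \<circ> \<rho> 1), ord (\<rho> 1 \<circ> \<rho> 2), ord (\<rho> 2 \<circ> \<rho> 3)]"
    proof -
      have "[1..<4] = [1,2,3::nat]" by (simp add: upt_rec)
      then show ?thesis by (simp add: schlafli_type_def len nth mult)
    qed
    moreover have "\<rho> i \<circ> \<rho> j \<in> carrier G" if "i < 4" "j < 4" for i j
      using m_closed[OF carr[OF that(1)] carr[OF that(2)]] mult by metis
    ultimately show ?thesis using ord order_01 order_12 order_23 by simp
  qed
  ultimately show ?thesis using len by (simp add: G)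
qed

end
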